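(* Let $d\ge 1$, $s\in(0,1)$ and $\alpha\in(s,1)$. There exists a constant $C>0$, depending only on $d$ and $s$, with the following property. Let $E\subset\mathbb{R}^d$ be an open set with $C^{1,\alpha}$ boundary and $0\in\partial E$. If $H_{s,E}(x)=0$ for every $x\in\partial E$, then \[ |E\cap B_R|\ge C\,|B_R|\qquad\text{for all }R>0. \]
   Context: $B_R$ is the open ball of radius $R$ centred at $0$, $B_\varepsilon(x)$ the open ball of radius $\varepsilon$ centred at $x$, and $|F|$ denotes Lebesgue measure. For a set $E$, $\tilde\chi_E=\chi_{\mathbb{R}^d\setminus E}-\chi_E$, where $\chi_F$ is the characteristic function of $F$. The $s$-mean curvature of $E$ at $x\in\partial E$ is \[ H_{s,E}(x)=\lim_{\varepsilon\to0^+}\int_{\mathbb{R}^d\setminus B_\varepsilon(x)}\frac{\tilde\chi_E(y)}{|x-y|^{d+s}}\,dy, \] whenever this limit exists. The hypothesis $H_{s,E}=0$ on $\partial E$ means that this limit exists and equals $0$ at every boundary point. *)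

theory Defs
  imports "HOL-Analysis.Analysis"
begin

definition chi_tilde :: "'a set \<Rightarrow> 'a \<Rightarrow> real" where
  "chi_tilde E y = (if y \<in> E then -1 else 1)"

definition trunc_s_curv :: "real \<Rightarrow> ('a::euclidean_space) set \<Rightarrow> 'a \<Rightarrow> real \<Rightarrow> real" where
  "trunc_s_curv s E x \<epsilon> =
     (\<integral>y. indicator (- ball x \<epsilon>) y * (chi_tilde E y / dist x y powr (real DIM('a) + s)) \<partial>lebesgue)"

definition s_mean_curvature_is :: "real \<Rightarrow> ('a::euclidean_space) set \<Rightarrow> 'a \<Rightarrow> real \<Rightarrow> bool" where
  "s_mean_curvature_is s E x c \<longleftrightarrow> ((\<lambda>\<epsilon>. trunc_s_curv s E x \<epsilon>) \<longlongrightarrow> c) (at_right 0)"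

text \<open>C^{1,alpha} boundary: near every boundary point, E is (in a suitable orientation
  given by a unit vector n) the strict subgraph of a C^{1,alpha} function g over the
  hyperplane orthogonal to n. The function g is taken on the whole space and only
  evaluated on the hyperplane n-perp (any C^{1,alpha} function on the hyperplane
  extends to one on the whole space by composing with the orthogonal projection).\<close>
definition C1_alpha_fun :: "real \<Rightarrow> ('a::euclidean_space \<Rightarrow> real) \<Rightarrow> bool" where
  "C1_alpha_fun \<alpha> g \<longleftrightarrow> (\<exists>g' L. (\<forall>y. (g has_derivative g' y) (at y)) \<and>
      (\<forall>y z. onorm (\<lambda>h. g' y h - g' z h) \<le> L * norm (y - z) powr \<alpha>))"

definition C1_alpha_boundary :: "real \<Rightarrow> ('a::euclidean_space) set \<Rightarrow> bool" where
  "C1_alpha_boundary \<alpha> E \<longleftrightarrow>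
     (\<forall>x \<in> frontier E. \<exists>r > 0. \<exists>n g. norm n = 1 \<and> C1_alpha_fun \<alpha> g \<and>
        (\<forall>y \<in> ball x r. y \<in> E \<longleftrightarrow> y \<bullet> n < g (y - (y \<bullet> n) *\<^sub>R n)))"

end

theory Submission
  imports Defs
begin

text \<open>
  Suppose a ball of radius r contained in the complement of E touches the boundary of E at x.
  Reflecting in x, the part of the curvature integral at x close to x is bounded below by minus
  the integral of the kernel over the region outside both tangent balls; since s < 1 this is at
  least -C r^(-s). The far part is also at least -C r^(-s). If E had very small density in the
  ball of radius r around x, the intermediate annuli would contribute an arbitrarily large
  multiple of r^(-s), so the curvature would be positive. Hence every exterior point z near 0, with
  r the distance of z to E, has |E \<inter> B(z, 2r)| at least \<delta> r^d, and Vitali's covering lemma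
  turns this into a lower bound for |E \<inter> B(0, R)|.
\<close>

section \<open>Change of variables and scaling of the truncated curvature\<close>

lemma lborel_integral_affine:
  fixes f :: "'a::euclidean_space \<Rightarrow> real"
  assumes [measurable]: "f \<in> borel_measurable borel" and c: "c \<noteq> 0"
  shows "(\<integral>y. f y \<partial>lborel) = \<bar>c\<bar> ^ DIM('a) * (\<integral>u. f (t + c *\<^sub>R u) \<partial>lborel)"
  by (subst lborel_affine[OF c, of t]) (simp add: integral_density integral_distr)

text \<open>Openness of \<open>E\<close> makes the integrand Borel measurable, so completing the
  measure does not change the integral, and the affine substitution for \<open>lborel\<close>
  becomes available.\<close>

lemma trunc_s_curv_lborel:
  fixes E :: "'a::euclidean_space set"
  assumes "open E"
  shows "trunc_s_curv s E x \<epsilon> =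
     (\<integral>y. indicator (- ball x \<epsilon>) y * (chi_tilde E y / dist x y powr (real DIM('a) + s)) \<partial>lborel)"
proof -
  have [measurable]: "E \<in> sets borel" using assms by simp
  show ?thesis
    unfolding trunc_s_curv_def chi_tilde_def by (intro integral_completion) measurable
qed

text \<open>Under y = x + r u the Jacobian r^d against the kernel |r u|^(-d-s) leaves the factor
  r^(-s). The curvature estimates can thus be made at the origin, with a tangent ball of radius
  1.\<close>

lemma trunc_s_curv_scale:
  fixes E :: "'a::euclidean_space set"
  assumes "open E" "r > 0"
  shows "trunc_s_curv s E x \<epsilon> = r powr (- s) * trunc_s_curv s ((\<lambda>u. x + r *\<^sub>R u) -` E) 0 (\<epsilon> / r)"
proof -
  have [measurable]: "E \<in> sets borel" using assms by simp
  have "open ((\<lambda>u. x + r *\<^sub>R u) -` E)"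
    by (intro continuous_open_vimage assms) (auto intro!: continuous_intros)
  have pw: "r ^ DIM('a) * (indicator (- ball x \<epsilon>) (x + r *\<^sub>R u) *
      (chi_tilde E (x + r *\<^sub>R u) / dist x (x + r *\<^sub>R u) powr (real DIM('a) + s)))
    = r powr (- s) * (indicator (- ball 0 (\<epsilon> / r)) u *
      (chi_tilde ((\<lambda>u. x + r *\<^sub>R u) -` E) u / dist 0 u powr (real DIM('a) + s)))" for u :: 'a
  proof -
    have "r ^ DIM('a) = r powr real DIM('a)"
      using assms by (simp add: powr_realpow)
    then have "r ^ DIM('a) / (r * norm u) powr (real DIM('a) + s)
      = r powr (- s) / norm u powr (real DIM('a) + s)"
      using assms by (simp add: powr_mult powr_add powr_minus field_simps)
    moreover have "indicator (- ball x \<epsilon>) (x + r *\<^sub>R u) = (indicator (- ball 0 (\<epsilon> / r)) u :: real)"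
      using assms by (simp add: indicator_def dist_norm field_simps)
    moreover have "chi_tilde E (x + r *\<^sub>R u) = chi_tilde ((\<lambda>u. x + r *\<^sub>R u) -` E) u"
      by (simp add: chi_tilde_def)
    ultimately have "indicator (- ball x \<epsilon>) (x + r *\<^sub>R u) * chi_tilde E (x + r *\<^sub>R u) *
        (r ^ DIM('a) / (r * norm u) powr (real DIM('a) + s)) =
      indicator (- ball 0 (\<epsilon> / r)) u * chi_tilde ((\<lambda>u. x + r *\<^sub>R u) -` E) u *
        (r powr (- s) / norm u powr (real DIM('a) + s))"
      by (simp only:)
    then show ?thesis using assms by (simp add: dist_norm mult_ac)
  qed
  have "trunc_s_curv s E x \<epsilon> = \<bar>r\<bar> ^ DIM('a) * (\<integral>u. indicator (- ball x \<epsilon>) (x + r *\<^sub>R u) *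
      (chi_tilde E (x + r *\<^sub>R u) / dist x (x + r *\<^sub>R u) powr (real DIM('a) + s)) \<partial>lborel)"
    unfolding trunc_s_curv_lborel[OF assms(1)] chi_tilde_def
    by (subst lborel_integral_affine[where c = r and t = x]) (use assms in \<open>auto\<close>)
  also have "\<dots> = r powr (- s) * trunc_s_curv s ((\<lambda>u. x + r *\<^sub>R u) -` E) 0 (\<epsilon> / r)"
    unfolding trunc_s_curv_lborel[OF \<open>open (_ -` E)\<close>] integral_mult_right_zero[symmetric]
    using assms by (simp only: pw abs_of_pos)
  finally show ?thesis .
qed

section \<open>Two measure estimates: null boundary and thin slabs\<close>

text \<open>Locally the boundary lies on a graph over a hyperplane, which is the image of a null set
  under a differentiable map of the space into itself. In the final covering this lets the boundary
  be discarded, leaving \<open>E\<close> and its exterior.\<close>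

lemma C1_alpha_boundary_imp_negligible_frontier:
  fixes E :: "'a::euclidean_space set"
  assumes "open E" "C1_alpha_boundary \<alpha> E"
  shows "negligible (frontier E)"
proof (rule locally_negligible_alt[THEN iffD2], rule ballI)
  fix x assume x: "x \<in> frontier E"
  then obtain r n g where r: "r > 0" and n: "norm n = 1" and g: "C1_alpha_fun \<alpha> g"
    and E: "\<forall>y \<in> ball x r. y \<in> E \<longleftrightarrow> y \<bullet> n < g (y - (y \<bullet> n) *\<^sub>R n)"
    using bspec[OF assms(2)[unfolded C1_alpha_boundary_def] x] by (elim exE conjE) (rule that)
  from g obtain g' where g': "\<And>y. (g has_derivative g' y) (at y)"
    unfolding C1_alpha_fun_def by blast
  then have gc: "continuous_on UNIV g"
    by (meson has_derivative_continuous continuous_at_imp_continuous_on)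
  \<comment> \<open>On the hyperplane orthogonal to \<open>n\<close>, \<open>f\<close> lifts a point
    to the graph of \<open>g\<close>.\<close>
  define f where "f = (\<lambda>y. y + g y *\<^sub>R n)"
  have "negligible {y. n \<bullet> y = 0}"
    using n by (intro negligible_hyperplane) auto
  moreover have "(f has_derivative (\<lambda>h. h + g' y h *\<^sub>R n)) (at y within T)" for y T
    unfolding f_def
    by (intro has_derivative_add has_derivative_ident has_derivative_scaleR_left
        has_derivative_at_withinI[OF g'])
  then have "f differentiable_on {y. n \<bullet> y = 0}"
    unfolding differentiable_on_def by (auto intro: differentiableI)
  ultimately have neg: "negligible (f ` {y. n \<bullet> y = 0})"
    by (intro negligible_differentiable_image_negligible) auto
  have "frontier E \<inter> ball x r \<subseteq> f ` {y. n \<bullet> y = 0}"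
  proof
    fix y assume y: "y \<in> frontier E \<inter> ball x r"
    define p where "p = (\<lambda>y. y - (y \<bullet> n) *\<^sub>R n)"
    have "y \<notin> E" using y assms(1) by (simp add: frontier_def interior_open)
    then have ge: "y \<bullet> n \<ge> g (p y)" using E y by (force simp: p_def)
    have "\<not> y \<bullet> n > g (p y)"
    proof
      assume less: "y \<bullet> n > g (p y)"
      \<comment> \<open>\<open>V\<close> is the part of \<open>ball x r\<close> strictly above the
        graph. It is open and misses \<open>E\<close>, hence misses the closure of \<open>E\<close>
        too, so it contains no frontier point.\<close>
      define V where "V = ball x r \<inter> {y. g (p y) < y \<bullet> n}"
      have "open V" unfolding V_def p_def
        by (intro open_Int open_ball open_Collect_less continuous_on_compose2[OF gc] continuous_intros) auto
      moreover have "V \<inter> E = {}" unfolding V_def using E by (force simp: p_def)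
      moreover have "y \<in> V" using less y by (simp add: V_def)
      ultimately show False
        using y by (metis IntD1 disjoint_iff frontier_def Diff_iff open_Int_closure_eq_empty)
    qed
    with ge have "y \<bullet> n = g (p y)" by simp
    then have "y = f (p y)" by (simp add: f_def) (simp add: p_def)
    moreover have "n \<bullet> p y = 0"
      using n by (simp add: p_def inner_diff_right inner_commute norm_eq_1)
    ultimately show "y \<in> f ` {y. n \<bullet> y = 0}" by blast
  qed
  then have "negligible (frontier E \<inter> ball x r)" using neg negligible_subset by blast
  moreover have "openin (top_of_set (frontier E)) (frontier E \<inter> ball x r)"
    by (simp add: openin_open_Int)
  ultimately show "\<exists>U. openin (top_of_set (frontier E)) U \<and> x \<in> U \<and> negligible U"
    using x r by (intro exI[of _ "frontier E \<inter> ball x r"]) auto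
qed

text \<open>About 1/t translates of the slab in the direction e are disjoint and fit into a ball of radius
  7 \<rho>, so no rotation of coordinates is needed.\<close>
lemma emeasure_slab_ball_le:
  fixes e :: "'a::euclidean_space"
  assumes e: "norm e = 1" and t: "0 < t" "t \<le> 1" and \<rho>: "\<rho> > 0"
  shows "emeasure lborel {u. norm u < \<rho> \<and> \<bar>u \<bullet> e\<bar> \<le> t * \<rho>}
          \<le> ennreal (unit_ball_vol DIM('a) * 7 ^ DIM('a) * \<rho> ^ DIM('a) * t)"
proof -
  define S where "S = {u. norm u < \<rho> \<and> \<bar>u \<bullet> e\<bar> \<le> t * \<rho>}"
  have [measurable]: "S \<in> sets borel" unfolding S_def by measurable
  \<comment> \<open>The slab has thickness 2 t \<rho> in the direction \<open>e\<close>, so shifts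
    by multiples of 3 t \<rho> make the copies disjoint.\<close>
  define T where "T = (\<lambda>j::nat. (+) ((3 * t * \<rho> * real j) *\<^sub>R e) ` S)"
  \<comment> \<open>At least 1/t copies produce the factor t in the bound; at most 1/t + 1 copies
    keep every shift within 6 \<rho>, hence every copy within radius 7 \<rho>.\<close>
  define m where "m = nat \<lceil>1 / t\<rceil>"
  have m: "real m \<ge> 1 / t" "real m \<le> 1 / t + 1"
    using t unfolding m_def by (auto simp: of_nat_nat le_of_int_ceiling of_int_ceiling_le_add_one)
  have T_inner: "\<bar>u \<bullet> e - 3 * t * \<rho> * real j\<bar> \<le> t * \<rho>" if "u \<in> T j" for u j
    using that e by (auto simp: T_def S_def inner_add_left norm_eq_1)
  have disj: "T i \<inter> T j = {}" if "i < j" for i j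
  proof -
    have "3 * t * \<rho> * real i + 3 * t * \<rho> \<le> 3 * t * \<rho> * real j"
    proof -
      have "3 * t * \<rho> * (real i + 1) \<le> 3 * t * \<rho> * real j"
        using that t \<rho> by (intro mult_left_mono) auto
      then show ?thesis by (simp add: algebra_simps)
    qed
    moreover have "t * \<rho> > 0" using t \<rho> by simp
    ultimately have False if "u \<in> T i" "u \<in> T j" for u
      using T_inner[OF that(1)] T_inner[OF that(2)] by linarith
    then show ?thesis by blast
  qed
  have T_sets[measurable]: "T j \<in> sets borel" for j
  proof -
    have "T j = (\<lambda>u. u - (3 * t * \<rho> * real j) *\<^sub>R e) -` S \<inter> space borel"
      unfolding T_def by (force simp: image_iff)
    also have "\<dots> \<in> sets borel"
      by (rule measurable_sets[where A = borel]) measurable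
    finally show ?thesis .
  qed
  have T_eq: "emeasure lborel (T j) = emeasure lborel S" for j
  proof -
    have "emeasure lebesgue (T j) = emeasure lebesgue S"
      unfolding T_def using emeasure_lebesgue_affine[of 1 "(3 * t * \<rho> * real j) *\<^sub>R e" S]
      by (simp add: add.commute)
    then show ?thesis by simp
  qed
  have sub: "(\<Union>j<m. T j) \<subseteq> ball 0 (7 * \<rho>)"
  proof
    fix u assume "u \<in> (\<Union>j<m. T j)"
    then obtain j v where j: "j < m" and v: "v \<in> S" "u = (3 * t * \<rho> * real j) *\<^sub>R e + v"
      by (auto simp: T_def)
    have "norm u \<le> 3 * t * \<rho> * real j + norm v"
      unfolding v(2) using e t \<rho> by (intro order_trans[OF norm_triangle_ineq]) simp
    also have "3 * t * \<rho> * real j \<le> 3 * t * \<rho> * (1 / t + 1)"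
      using m j t \<rho> by (intro mult_left_mono) auto
    also have "\<dots> = 3 * \<rho> + 3 * \<rho> * t" using t by (simp add: field_simps)
    also have "3 * \<rho> * t \<le> 3 * \<rho>" using t \<rho> by simp
    finally have "norm u < 7 * \<rho>" using v(1) by (simp add: S_def)
    then show "u \<in> ball 0 (7 * \<rho>)" by simp
  qed
  have fin: "emeasure lborel S \<le> emeasure lborel (ball (0::'a) \<rho>)"
    by (intro emeasure_mono) (auto simp: S_def)
  then have S_eq: "emeasure lborel S = ennreal (measure lborel S)"
    using \<rho> by (intro emeasure_eq_ennreal_measure) (auto simp: emeasure_ball top_unique)
  have "of_nat m * emeasure lborel S = (\<Sum>j<m. emeasure lborel (T j))"
    by (simp add: T_eq)
  also have "\<dots> = emeasure lborel (\<Union>j<m. T j)"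
  proof (rule sum_emeasure)
    show "disjoint_family_on T {..<m}"
      unfolding disjoint_family_on_def using disj by (metis Int_commute neq_iff)
  qed auto
  also have "\<dots> \<le> emeasure lborel (ball (0::'a) (7 * \<rho>))"
    using sub by (intro emeasure_mono) auto
  finally have "ennreal (real m * measure lborel S) \<le> ennreal (unit_ball_vol DIM('a) * (7 * \<rho>) ^ DIM('a))"
    using \<rho> by (simp add: S_eq emeasure_ball ennreal_mult' ennreal_of_nat_eq_real_of_nat)
  then have "real m * measure lborel S \<le> unit_ball_vol DIM('a) * (7 * \<rho>) ^ DIM('a)"
    using \<rho> by (simp add: ennreal_le_iff)
  moreover have "1 / t * measure lborel S \<le> real m * measure lborel S"
    using m by (intro mult_right_mono) auto
  ultimately have "1 / t * measure lborel S \<le> unit_ball_vol DIM('a) * (7 * \<rho>) ^ DIM('a)"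
    by linarith
  then have "measure lborel S \<le> unit_ball_vol DIM('a) * (7 * \<rho>) ^ DIM('a) * t"
    using t by (simp add: field_simps)
  then show ?thesis
    using S_eq unfolding S_def[symmetric] by (simp add: power_mult_distrib mult_ac ennreal_leI)
qed

section \<open>Dyadic sums for the kernel, far away and between the tangent balls\<close>

lemma powr_of_power:
  fixes b :: real
  assumes "b > 0"
  shows "(b ^ k) powr x = (b powr x) ^ k"
  using assms by (simp add: powr_realpow[symmetric] powr_powr mult.commute)

lemma dyadic_scale_ge_1:
  fixes x :: real
  assumes "x \<ge> 1"
  obtains k where "2 ^ k \<le> x" "x < 2 ^ Suc k"
proof -
  define n where "n = (LEAST n. x < 2 ^ n)"
  have n: "x < 2 ^ n"
    unfolding n_def by (rule LeastI_ex) (simp add: real_arch_pow)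
  then obtain k where k: "n = Suc k"
    using assms by (cases n) auto
  then have "\<not> x < 2 ^ k"
    by (metis lessI n_def not_less_Least)
  then show ?thesis using that[of k] n k by simp
qed

lemma dyadic_scale_lt_1:
  fixes x :: real
  assumes "0 < x" "x < 1"
  obtains k where "(1 / 2) ^ Suc k \<le> x" "x < (1 / 2) ^ k"
proof -
  define n where "n = (LEAST n. (1 / 2) ^ n \<le> x)"
  have "\<exists>n. (1 / 2) ^ n \<le> x"
    using real_arch_pow_inv[of x "1 / 2"] assms by (auto intro: less_imp_le)
  then have n: "(1 / 2) ^ n \<le> x"
    unfolding n_def by (rule LeastI_ex)
  then obtain k where k: "n = Suc k"
    using assms by (cases n) auto
  then have "\<not> (1 / 2) ^ k \<le> x"
    by (metis lessI n_def not_less_Least)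
  then show ?thesis using that[of k] n k by simp
qed

text \<open>The function is dominated by the sum of the multiples \<open>c k\<close> of the
  indicators of \<open>S k\<close>, which is integrated termwise. The sets may overlap, so whole
  balls or slabs can stand in for dyadic shells.\<close>

lemma nn_integral_le_geometric:
  fixes f :: "'a \<Rightarrow> ennreal" and c :: "nat \<Rightarrow> real"
  assumes [measurable]: "\<And>k. S k \<in> sets M"
    and f: "\<And>u. f u = 0 \<or> (\<exists>k. u \<in> S k \<and> f u \<le> ennreal (c k))"
    and le: "\<And>k. ennreal (c k) * emeasure M (S k) \<le> ennreal (a * q ^ k)"
    and q: "0 \<le> q" "q < 1" and a: "a \<ge> 0"
  shows "(\<integral>\<^sup>+u. f u \<partial>M) \<le> ennreal (a / (1 - q))"
proof -
  have "(\<integral>\<^sup>+u. f u \<partial>M) \<le> (\<integral>\<^sup>+u. (\<Sum>k. ennreal (c k) * indicator (S k) u) \<partial>M)"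
  proof (rule nn_integral_mono)
    fix u
    show "f u \<le> (\<Sum>k. ennreal (c k) * indicator (S k) u)"
    proof (cases "f u = 0")
      case False
      then obtain k where k: "u \<in> S k" "f u \<le> ennreal (c k)" using f by blast
      have "f u \<le> (\<Sum>k\<in>{k}. ennreal (c k) * indicator (S k) u)" using k by simp
      also have "\<dots> \<le> (\<Sum>k. ennreal (c k) * indicator (S k) u)"
        by (rule sum_le_suminf) auto
      finally show ?thesis .
    qed simp
  qed
  also have "\<dots> = (\<Sum>k. ennreal (c k) * emeasure M (S k))"
    by (subst nn_integral_suminf) (auto simp: nn_integral_cmult_indicator)
  also have "\<dots> \<le> (\<Sum>k. ennreal (a * q ^ k))"
    by (intro suminf_le le) auto
  also have "\<dots> = ennreal (a / (1 - q))"
  proof (rule suminf_ennreal_eq)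
    show "(\<lambda>k. a * q ^ k) sums (a / (1 - q))"
      using sums_mult[OF geometric_sums[of q], of a] q by simp
  qed (use a q in auto)
  finally show ?thesis .
qed

text \<open>On the shell |u| ~ 2^k \<rho> the kernel is of order (2^k \<rho>)^(-d-s) and the volume
  of order (2^k \<rho>)^d, so the contributions decay like 2^(-s k). This controls the far part of
  the curvature and makes every truncated integrand integrable.\<close>

lemma integrable_norm_powr_tail:
  fixes s \<rho> :: real
  assumes "s > 0" "\<rho> > 0"
  shows "integrable lborel (\<lambda>u::'a::euclidean_space.
           indicator (- ball 0 \<rho>) u / norm u powr (real DIM('a) + s))"
proof (rule integrableI_nonneg)
  define S where "S = (\<lambda>k::nat. ball (0::'a) (2 ^ Suc k * \<rho>))"
  define D where "D = real DIM('a) + s"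
  define a where "a = unit_ball_vol DIM('a) * 2 ^ DIM('a) * \<rho> powr (- s)"
  have "(\<integral>\<^sup>+u. ennreal (indicator (- ball (0::'a) \<rho>) u / norm u powr D) \<partial>lborel)
    \<le> ennreal (a / (1 - 2 powr (- s)))"
  proof (rule nn_integral_le_geometric[where S = S and c = "\<lambda>k. 1 / (2 ^ k * \<rho>) powr D"])
    show "S k \<in> sets lborel" for k by (simp add: S_def)
    show "0 \<le> a" using assms by (simp add: a_def)
    show "2 powr (- s) < 1" using assms by (simp add: powr_less_one)
    show "ennreal (indicator (- ball 0 \<rho>) u / norm u powr D) = 0 \<or>
      (\<exists>k. u \<in> S k \<and> ennreal (indicator (- ball 0 \<rho>) u / norm u powr D)
                        \<le> ennreal (1 / (2 ^ k * \<rho>) powr D))" for u :: 'a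
    proof (cases "u \<in> ball 0 \<rho>")
      case False
      then have "norm u / \<rho> \<ge> 1" using assms by simp
      then obtain k where "2 ^ k \<le> norm u / \<rho>" "norm u / \<rho> < 2 ^ Suc k"
        by (rule dyadic_scale_ge_1)
      then have k: "2 ^ k * \<rho> \<le> norm u" "norm u < 2 ^ Suc k * \<rho>"
        using assms by (simp_all add: field_simps)
      have "(2 ^ k * \<rho>) powr D \<le> norm u powr D"
        using k assms by (intro powr_mono2) (auto simp: D_def)
      then have "1 / norm u powr D \<le> 1 / (2 ^ k * \<rho>) powr D"
        using assms by (intro divide_left_mono mult_pos_pos) (use False in auto)
      then show ?thesis using k False by (auto simp: S_def intro!: exI[of _ k] ennreal_leI)
    qed simp
    show "ennreal (1 / (2 ^ k * \<rho>) powr D) * emeasure lborel (S k) \<le> ennreal (a * (2 powr (- s)) ^ k)" for k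
    proof -
      define \<sigma> where "\<sigma> = 2 ^ k * \<rho>"
      have \<sigma>: "\<sigma> > 0" using assms by (simp add: \<sigma>_def)
      have "1 / \<sigma> powr D * (unit_ball_vol DIM('a) * (2 * \<sigma>) ^ DIM('a))
        = unit_ball_vol DIM('a) * 2 ^ DIM('a) * (\<sigma> ^ DIM('a) / \<sigma> powr D)"
        by (simp add: power_mult_distrib)
      also have "\<sigma> ^ DIM('a) / \<sigma> powr D = \<sigma> powr (- s)"
        using \<sigma> by (simp add: D_def powr_realpow[symmetric] powr_diff[symmetric])
      also have "\<dots> = (2 powr (- s)) ^ k * \<rho> powr (- s)"
        using assms by (simp add: \<sigma>_def powr_mult powr_of_power)
      finally have "1 / \<sigma> powr D * (unit_ball_vol DIM('a) * (2 * \<sigma>) ^ DIM('a)) = a * (2 powr (- s)) ^ k"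
        by (simp add: a_def mult_ac)
      moreover have "S k = ball 0 (2 * \<sigma>)" by (simp add: S_def \<sigma>_def mult.assoc)
      moreover have "ennreal (1 / \<sigma> powr D) * emeasure lborel (ball (0::'a) (2 * \<sigma>))
        = ennreal (1 / \<sigma> powr D * (unit_ball_vol DIM('a) * (2 * \<sigma>) ^ DIM('a)))"
        unfolding emeasure_ball[OF less_imp_le[OF mult_pos_pos[OF zero_less_numeral \<sigma>]]]
        by (rule ennreal_mult'[symmetric]) simp
      ultimately show ?thesis by (simp add: \<sigma>_def)
    qed
  qed simp
  also have "\<dots> < \<infinity>" by simp
  finally show "(\<integral>\<^sup>+u. ennreal (indicator (- ball (0::'a) \<rho>) u / norm u powr (real DIM('a) + s)) \<partial>lborel) < \<infinity>"
    by (simp add: D_def)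
qed auto

text \<open>For a unit vector e, the points of the unit ball outside both tangent balls \<open>ball e 1\<close> and
  \<open>ball (-e) 1\<close>.\<close>
definition wedge :: "'a::euclidean_space \<Rightarrow> 'a set" where
  "wedge e = {u. norm u < 1 \<and> \<bar>u \<bullet> e\<bar> \<le> (norm u)\<^sup>2 / 2}"

lemma wedge_borel [measurable]: "wedge e \<in> sets borel"
  unfolding wedge_def by measurable

text \<open>Where |u| ~ 2^(-k) the wedge lies in a slab of width about 4^(-k), so its volume there
  is of order 2^(-k(d+1)), against a kernel of order 2^(k(d+s)). The contributions decay like
  2^(-k(1-s)), which is where s < 1 enters. One \<open>I\<close> serves all directions
  \<open>e\<close>.\<close>

lemma nn_integral_wedge_bound:
  fixes s :: real
  assumes "0 < s" "s < 1"
  obtains I :: real where "I \<ge> 0"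
    "\<And>e::'a::euclidean_space. norm e = 1 \<Longrightarrow>
       (\<integral>\<^sup>+u. ennreal (indicator (wedge e) u / norm u powr (real DIM('a) + s)) \<partial>lborel) \<le> ennreal I"
proof -
  define D where "D = real DIM('a) + s"
  \<comment> \<open>The factor 7^d comes from the slab estimate, and \<open>2 powr D\<close> from
    evaluating the kernel at the inner radius (1/2)^(k+1) of a shell.\<close>
  define a where "a = unit_ball_vol DIM('a) * 7 ^ DIM('a) * 2 powr D"
  define q :: real where "q = (1 / 2) powr (1 - s)"
  have a: "a \<ge> 0" by (simp add: a_def)
  have q: "0 \<le> q" "q < 1" using assms using powr_less_mono2[of "1 - s" "1 / 2" 1] by (auto simp: q_def)
  have "(\<integral>\<^sup>+u. ennreal (indicator (wedge e) u / norm u powr D) \<partial>lborel) \<le> ennreal (a / (1 - q))"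
    if e: "norm e = 1" for e :: 'a
  proof (rule nn_integral_le_geometric[OF _ _ _ q a])
    \<comment> \<open>The half-width is written as a product so that the slab estimate applies with
      t = \<rho> = (1/2)^k.\<close>
    define S where "S = (\<lambda>k::nat. {u. norm u < (1 / 2) ^ k \<and> \<bar>u \<bullet> e\<bar> \<le> (1 / 2) ^ k * (1 / 2) ^ k})"
    show "S k \<in> sets lborel" for k unfolding S_def by measurable
    show "ennreal (indicator (wedge e) u / norm u powr D) = 0 \<or>
      (\<exists>k. u \<in> S k \<and> ennreal (indicator (wedge e) u / norm u powr D)
                        \<le> ennreal (1 / ((1 / 2) ^ Suc k) powr D))" for u :: 'a
    \<comment> \<open>At the origin the denominator is \<open>0 powr D\<close> = 0 and the quotient
      is 0 by convention, so this point needs no shell.\<close>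
    proof (cases "u \<in> wedge e \<and> u \<noteq> 0")
      case True
      then have "0 < norm u" "norm u < 1" by (auto simp: wedge_def)
      then obtain k where k: "(1 / 2) ^ Suc k \<le> norm u" "norm u < (1 / 2) ^ k"
        by (rule dyadic_scale_lt_1)
      have "((1 / 2) ^ Suc k) powr D \<le> norm u powr D"
        using k assms by (intro powr_mono2) (auto simp: D_def)
      then have "1 / norm u powr D \<le> 1 / ((1 / 2) ^ Suc k) powr D"
        using True by (intro divide_left_mono mult_pos_pos) auto
      moreover have "norm u * norm u \<le> (1 / 2) ^ k * (1 / 2) ^ k"
        using k by (intro mult_mono) auto
      then have "u \<in> S k"
        using True k by (auto simp: wedge_def S_def power2_eq_square)
      ultimately show ?thesis using True by (auto intro!: exI[of _ k] ennreal_leI)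
    qed auto
    show "ennreal (1 / ((1 / 2) ^ Suc k) powr D) * emeasure lborel (S k) \<le> ennreal (a * q ^ k)" for k
    proof -
      define \<sigma> :: real where "\<sigma> = (1 / 2) ^ k"
      have \<sigma>: "0 < \<sigma>" "\<sigma> \<le> 1" by (auto simp: \<sigma>_def power_le_one)
      have "emeasure lborel (S k) \<le> ennreal (unit_ball_vol DIM('a) * 7 ^ DIM('a) * \<sigma> ^ DIM('a) * \<sigma>)"
        using emeasure_slab_ball_le[OF e \<sigma> \<sigma>(1)] by (simp add: S_def \<sigma>_def[symmetric])
      then have "ennreal (1 / (\<sigma> / 2) powr D) * emeasure lborel (S k)
        \<le> ennreal (1 / (\<sigma> / 2) powr D) * ennreal (unit_ball_vol DIM('a) * 7 ^ DIM('a) * \<sigma> ^ DIM('a) * \<sigma>)"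
        by (rule mult_left_mono) simp
      also have "\<dots> = ennreal (1 / (\<sigma> / 2) powr D * (unit_ball_vol DIM('a) * 7 ^ DIM('a) * \<sigma> ^ DIM('a) * \<sigma>))"
        using \<sigma> by (intro ennreal_mult'[symmetric]) auto
      also have "1 / (\<sigma> / 2) powr D * (unit_ball_vol DIM('a) * 7 ^ DIM('a) * \<sigma> ^ DIM('a) * \<sigma>)
        = a * (\<sigma> ^ DIM('a) * \<sigma> / \<sigma> powr D)"
        using \<sigma> by (simp add: a_def powr_divide)
      also have "\<sigma> ^ DIM('a) * \<sigma> / \<sigma> powr D = \<sigma> powr (1 - s)"
        using \<sigma> by (simp add: D_def powr_realpow[symmetric] powr_add powr_diff)
      also have "\<dots> = q ^ k" by (simp add: \<sigma>_def q_def powr_of_power)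
      finally show ?thesis by (simp add: \<sigma>_def)
    qed
  qed
  then show ?thesis using that[of "a / (1 - q)"] a q by (simp add: D_def)
qed

section \<open>Positive curvature at a tangent exterior ball when the density is small\<close>

text \<open>The space is split at the radii \<eta> and 1. The inner part is at least -I by
  reflection and the outer part at least -T. In between, one annulus gains at least I + T + 2, and
  the points of \<open>E\<close> cost at most 1. Since I and T depend only on d and s, so do
  \<delta> and \<eta>.\<close>

lemma trunc_s_curv_ge_1:
  fixes s :: real
  assumes s: "0 < s" "s < 1"
  obtains \<delta> \<eta> :: real where "\<delta> > 0" "\<eta> > 0"
    "\<And>(E::'a::euclidean_space set) e \<epsilon>. \<lbrakk>open E; norm e = 1; E \<inter> ball e 1 = {};
       measure lebesgue (E \<inter> ball 0 1) \<le> \<delta>; 0 < \<epsilon>; \<epsilon> < \<eta>\<rbrakk> \<Longrightarrow> trunc_s_curv s E 0 \<epsilon> \<ge> 1"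
proof -
  define D where "D = real DIM('a) + s"
  define \<omega> where "\<omega> = unit_ball_vol (real DIM('a))"
  obtain I :: real where I: "I \<ge> 0"
    "\<And>e::'a. norm e = 1 \<Longrightarrow> (\<integral>\<^sup>+u. ennreal (indicator (wedge e) u / norm u powr D) \<partial>lborel) \<le> ennreal I"
    using nn_integral_wedge_bound[OF s, where 'a = 'a] unfolding D_def by blast
  define T where "T = (\<integral>u. indicator (- ball (0::'a) 1) u / norm u powr D \<partial>lborel)"
  have T: "T \<ge> 0" unfolding T_def by (intro integral_nonneg_AE) auto
  \<comment> \<open>The annulus between \<eta> and 2 \<eta> has volume \<omega> (2^d - 1) \<eta>^d,
    and the kernel there is at least (2 \<eta>)^(-D); the product is b \<eta>^(-s).\<close>
  define b where "b = \<omega> * (2 ^ DIM('a) - 1) / 2 powr D"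
  have b: "b > 0"
    by (auto simp: b_def \<omega>_def intro!: divide_pos_pos mult_pos_pos one_less_power)
  \<comment> \<open>The second entry makes b \<eta>^(-s) at least I + T + 2; the cap 1/2 keeps the
    annulus inside the unit ball.\<close>
  define \<eta> where "\<eta> = min (1 / 2) ((b / (I + T + 2)) powr (1 / s))"
  \<comment> \<open>Beyond radius \<eta> a point of \<open>E\<close> lowers the integrand by at most
    2 \<eta>^(-D) compared with a point of the complement, so measure \<delta> costs at most
    1.\<close>
  define \<delta> where "\<delta> = \<eta> powr D / 2"
  have \<eta>: "0 < \<eta>" "\<eta> \<le> 1 / 2" using b I T by (auto simp: \<eta>_def)
  have "\<eta> powr s \<le> ((b / (I + T + 2)) powr (1 / s)) powr s"
    using \<eta> s by (intro powr_mono2) (auto simp: \<eta>_def)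
  also have "\<dots> = b / (I + T + 2)" using b I T s by (simp add: powr_powr)
  finally have b_\<eta>: "I + T + 2 \<le> b * \<eta> powr (- s)"
    using \<eta> I T by (simp add: powr_minus field_simps)
  have "trunc_s_curv s E 0 \<epsilon> \<ge> 1"
    if E: "open E" "norm e = 1" "E \<inter> ball e 1 = {}" "measure lebesgue (E \<inter> ball 0 1) \<le> \<delta>"
      and \<epsilon>: "0 < \<epsilon>" "\<epsilon> < \<eta>" for E and e :: 'a and \<epsilon>
  proof -
    have [measurable]: "E \<in> sets borel" using E by simp
    define F where "F = (\<lambda>u. indicator (- ball 0 \<epsilon>) u * (chi_tilde E u / dist 0 u powr D))"
    define F1 where "F1 = (\<lambda>u. indicator (ball 0 \<eta>) u * F u)"
    have F_meas [measurable]: "F \<in> borel_measurable borel"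
      unfolding F_def chi_tilde_def by measurable
    have F1_meas [measurable]: "F1 \<in> borel_measurable borel"
      unfolding F1_def by (intro borel_measurable_times borel_measurable_indicator F_meas) auto
    have F_bound: "\<bar>F u\<bar> = indicator (- ball 0 \<epsilon>) u / norm u powr D" for u
      by (simp add: F_def chi_tilde_def abs_mult)
    have F_int: "integrable lborel F"
      by (rule Bochner_Integration.integrable_bound[OF integrable_norm_powr_tail[OF s(1) \<epsilon>(1)]])
        (auto simp: F_bound D_def)
    have F1_int: "integrable lborel F1"
      by (rule Bochner_Integration.integrable_bound[OF F_int]) (auto simp: F1_def indicator_def)
    define W where "W = (\<lambda>u. indicator (wedge e) u / norm u powr D)"
    have W_int: "integrable lborel W" unfolding W_def
      by (rule integrableI_nonneg) (auto intro: le_less_trans[OF I(2)[OF E(2)]])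
    have W_le: "(\<integral>u. W u \<partial>lborel) \<le> I"
    proof -
      have "ennreal (\<integral>u. W u \<partial>lborel) = (\<integral>\<^sup>+u. ennreal (W u) \<partial>lborel)"
        by (rule nn_integral_eq_integral[symmetric, OF W_int]) (auto simp: W_def)
      also have "\<dots> \<le> ennreal I" using I(2)[OF E(2)] by (simp add: W_def)
      finally show ?thesis using I(1) by (simp add: ennreal_le_iff)
    qed
    \<comment> \<open>Off the wedge at most one of \<open>u\<close> and \<open>- u\<close> lies in
      \<open>E\<close>, so the two signs sum to at least 0; on the wedge they sum to at least -2.
      The bound -I obtained from this does not depend on \<epsilon>, as the passage to the limit
      requires.\<close>
    have refl: "- 2 * W u \<le> F1 u + F1 (- u)" for u
    proof (cases "u \<in> ball 0 \<eta> - ball 0 \<epsilon>")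
      case True
      then have u: "norm u < \<eta>" "\<epsilon> \<le> norm u" by auto
      then have Fs: "F1 u = chi_tilde E u / norm u powr D" "F1 (- u) = chi_tilde E (- u) / norm u powr D"
        by (auto simp: F1_def F_def)
      show ?thesis
      proof (cases "u \<in> wedge e")
        case True
        then show ?thesis unfolding Fs W_def
          by (auto simp: chi_tilde_def add_divide_distrib[symmetric] intro!: divide_right_mono)
      next
        case False
        then have "(norm u)\<^sup>2 / 2 < \<bar>u \<bullet> e\<bar>" using u \<eta> by (auto simp: wedge_def)
        \<comment> \<open>By this identity v lies in \<open>ball e 1\<close> exactly if v \<bullet>
          e > |v|^2 / 2, and off the wedge this holds for \<open>u\<close> or for
          \<open>- u\<close>.\<close>
        moreover have "(norm (e - v))\<^sup>2 = 1 - 2 * (v \<bullet> e) + (norm v)\<^sup>2" for v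
          using E(2) by (simp add: power2_norm_eq_inner inner_diff inner_commute norm_eq_1)
        ultimately have "(norm (e - u))\<^sup>2 < 1\<^sup>2 \<or> (norm (e - (- u)))\<^sup>2 < 1\<^sup>2"
          by (simp only: inner_minus_left norm_minus_cancel) (auto simp: abs_if split: if_splits)
        then have "u \<in> ball e 1 \<or> - u \<in> ball e 1"
          by (metis mem_ball dist_norm power2_less_imp_less zero_le_one)
        then have "u \<notin> E \<or> - u \<notin> E" using E(3) by blast
        then show ?thesis using False unfolding Fs W_def
          by (auto simp: chi_tilde_def)
      qed
    next
      case False
      then have "F1 u = 0" "F1 (- u) = 0" by (auto simp: F1_def F_def)
      then show ?thesis by (simp add: W_def)
    qed
    have F1_refl: "(\<integral>u. F1 (- u) \<partial>lborel) = (\<integral>u. F1 u \<partial>lborel)"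
      using lborel_integral_affine[OF F1_meas, of "-1" 0] by simp
    have F1_refl_int: "integrable lborel (\<lambda>u. F1 (- u))"
      by (rule Bochner_Integration.integrable_bound[OF F1_int])
        (auto simp: F1_def abs_mult F_bound indicator_def)
    have "(\<integral>u. - 2 * W u \<partial>lborel) \<le> (\<integral>u. F1 u + F1 (- u) \<partial>lborel)"
      using W_int F1_int F1_refl_int refl by (intro integral_mono) auto
    also have "\<dots> = 2 * (\<integral>u. F1 u \<partial>lborel)"
      using F1_int F1_refl_int by (simp add: F1_refl)
    finally have F1_ge: "(\<integral>u. F1 u \<partial>lborel) \<ge> - I" using W_le by simp
    define A where "A = ball (0::'a) (2 * \<eta>) - ball 0 \<eta>"
    have [measurable]: "A \<in> sets borel" by (simp add: A_def)
    \<comment> \<open>\<open>L1\<close> is the gain on the annulus, \<open>L2\<close> bounds the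
      loss caused by \<open>E\<close> in the unit ball, and \<open>L3\<close> is the loss if
      everything outside the unit ball belonged to \<open>E\<close>.\<close>
    define L1 where "L1 = (\<lambda>u. indicator A u / norm u powr D)"
    define L2 where "L2 = (\<lambda>u. (2 / \<eta> powr D) * indicator (E \<inter> ball 0 1) u)"
    define L3 where "L3 = (\<lambda>u. indicator (- ball (0::'a) 1) u / norm u powr D)"
    have L1_int: "integrable lborel L1"
      by (rule Bochner_Integration.integrable_bound[OF integrable_norm_powr_tail[OF s(1) \<eta>(1)]])
        (auto simp: L1_def A_def D_def indicator_def)
    have EB_fin: "emeasure lborel (E \<inter> ball 0 1) < \<infinity>"
      by (rule le_less_trans[OF emeasure_mono[of _ "ball 0 1"]]) (auto simp: emeasure_ball)
    have L2_int: "integrable lborel L2"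
      unfolding L2_def using EB_fin by (intro integrable_mult_right integrable_real_indicator) auto
    have L3_int: "integrable lborel L3"
      unfolding L3_def D_def by (rule integrable_norm_powr_tail) (use s in auto)
    have A_vol: "measure lborel A = \<omega> * (2 ^ DIM('a) - 1) * \<eta> ^ DIM('a)"
    proof -
      have "measure lborel A = measure lborel (ball (0::'a) (2 * \<eta>)) - measure lborel (ball (0::'a) \<eta>)"
        unfolding A_def using \<eta> by (intro measure_Diff) (auto simp: emeasure_ball)
      also have "\<dots> = \<omega> * (2 * \<eta>) ^ DIM('a) - \<omega> * \<eta> ^ DIM('a)"
        using \<eta> by (simp add: content_ball \<omega>_def)
      finally show ?thesis by (simp add: power_mult_distrib algebra_simps)
    qed
    have A_fin: "emeasure lborel A < \<infinity>"
      by (rule le_less_trans[OF emeasure_mono[of _ "ball 0 (2 * \<eta>)"]])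
        (use \<eta> in \<open>auto simp: A_def emeasure_ball\<close>)
    have "b * \<eta> powr (- s) = 1 / (2 * \<eta>) powr D * measure lborel A"
    proof -
      have "(2 * \<eta>) powr D = 2 powr D * (\<eta> ^ DIM('a) * \<eta> powr s)"
        using \<eta> by (simp add: D_def powr_mult powr_add powr_realpow)
      then show ?thesis using \<eta> by (simp add: A_vol b_def powr_minus_divide)
    qed
    also have "\<dots> = (\<integral>u. 1 / (2 * \<eta>) powr D * indicator A u \<partial>lborel)"
      by simp
    also have "\<dots> \<le> (\<integral>u. L1 u \<partial>lborel)"
    proof (intro integral_mono L1_int integrable_mult_right integrable_real_indicator A_fin)
      show "1 / (2 * \<eta>) powr D * indicator A u \<le> L1 u" for u
      proof (cases "u \<in> A")
        case True
        then have "norm u powr D \<le> (2 * \<eta>) powr D" "norm u > 0"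
          using s \<eta> by (auto simp: A_def D_def intro!: powr_mono2)
        then show ?thesis using True \<eta> by (auto simp: L1_def intro!: divide_left_mono mult_pos_pos)
      qed (simp add: L1_def)
    qed auto
    finally have L1_ge: "I + T + 2 \<le> (\<integral>u. L1 u \<partial>lborel)" using b_\<eta> by simp
    have "measure lborel (E \<inter> ball 0 1) \<le> \<delta>" using E(4) by simp
    then have "2 / \<eta> powr D * measure lborel (E \<inter> ball 0 1) \<le> 2 / \<eta> powr D * \<delta>"
      by (intro mult_left_mono) auto
    also have "\<dots> = 1" using \<eta> by (simp add: \<delta>_def)
    finally have L2_le: "(\<integral>u. L2 u \<partial>lborel) \<le> 1" by (simp add: L2_def)
    have L3_eq: "(\<integral>u. L3 u \<partial>lborel) = T" by (simp add: L3_def T_def)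
    have ptw: "F1 u + L1 u - L2 u - L3 u \<le> F u" for u
    proof -
      consider "norm u < \<eta>" | "\<eta> \<le> norm u" "norm u < 1" | "norm u \<ge> 1" by linarith
      then show ?thesis
      proof cases
        case 1
        then show ?thesis using \<eta> by (simp add: F1_def L1_def L2_def L3_def A_def)
      next
        case 2
        then have "\<eta> powr D \<le> norm u powr D"
          using s \<eta> by (auto simp: D_def intro!: powr_mono2)
        then have "2 / norm u powr D \<le> 2 / \<eta> powr D"
          using 2 \<eta> by (auto intro!: divide_left_mono mult_pos_pos)
        moreover have "L1 u \<le> 1 / norm u powr D" by (simp add: L1_def indicator_def)
        moreover have "F u = chi_tilde E u / norm u powr D" using 2 \<epsilon> by (simp add: F_def)
        ultimately show ?thesis using 2
          by (cases "u \<in> E") (auto simp: F1_def L2_def L3_def chi_tilde_def)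
      next
        case 3
        then have "u \<notin> A" "L2 u = 0" "F1 u = 0" "L3 u = 1 / norm u powr D"
          using \<eta> by (auto simp: A_def L2_def L3_def F1_def)
        moreover have "F u = chi_tilde E u / norm u powr D" using 3 \<epsilon> \<eta> by (simp add: F_def)
        ultimately show ?thesis by (simp add: L1_def chi_tilde_def)
      qed
    qed
    have "(\<integral>u. F1 u + L1 u - L2 u - L3 u \<partial>lborel) \<le> (\<integral>u. F u \<partial>lborel)"
      using F1_int L1_int L2_int L3_int F_int ptw by (intro integral_mono) auto
    also have "(\<integral>u. F1 u + L1 u - L2 u - L3 u \<partial>lborel) =
      (\<integral>u. F1 u \<partial>lborel) + (\<integral>u. L1 u \<partial>lborel) - (\<integral>u. L2 u \<partial>lborel) - (\<integral>u. L3 u \<partial>lborel)"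
      using F1_int L1_int L2_int L3_int by simp
    finally have "1 \<le> (\<integral>u. F u \<partial>lborel)" using F1_ge L1_ge L2_le L3_eq by linarith
    then show ?thesis
      unfolding trunc_s_curv_lborel[OF E(1)] F_def D_def .
  qed
  moreover have "\<delta> > 0" using \<eta> by (simp add: \<delta>_def)
  ultimately show ?thesis using that \<eta> by blast
qed

text \<open>Blowing up at the contact point \<open>x\<close> by the factor 1/r turns the exterior
  ball into \<open>ball e 1\<close>. If \<open>E\<close> had too little volume, the truncated
  curvatures would stay above a positive constant, and their limit could not be 0.\<close>

lemma volume_near_tangent_exterior_ball:
  fixes s :: real
  assumes s: "0 < s" "s < 1"
  obtains \<delta> :: real where "\<delta> > 0"
    "\<And>(E::'a::euclidean_space set) x z r. \<lbrakk>open E; s_mean_curvature_is s E x 0; r > 0; dist z x = r;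
       E \<inter> ball z r = {}\<rbrakk> \<Longrightarrow> \<delta> * r ^ DIM('a) \<le> measure lebesgue (E \<inter> ball z (2 * r))"
proof -
  obtain \<delta> \<eta> :: real where \<delta>: "\<delta> > 0" "\<eta> > 0"
    and curv: "\<And>(E::'a set) e \<epsilon>. \<lbrakk>open E; norm e = 1; E \<inter> ball e 1 = {};
       measure lebesgue (E \<inter> ball 0 1) \<le> \<delta>; 0 < \<epsilon>; \<epsilon> < \<eta>\<rbrakk> \<Longrightarrow> trunc_s_curv s E 0 \<epsilon> \<ge> 1"
    using trunc_s_curv_ge_1[OF s] by metis
  have "\<delta> * r ^ DIM('a) \<le> measure lebesgue (E \<inter> ball z (2 * r))"
    if E: "open E" and H: "s_mean_curvature_is s E x 0" and r: "r > 0" and z: "dist z x = r"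
      and ext: "E \<inter> ball z r = {}" for E and x z :: 'a and r
  proof (rule ccontr)
    assume small: "\<not> \<delta> * r ^ DIM('a) \<le> measure lebesgue (E \<inter> ball z (2 * r))"
    define E' where "E' = (\<lambda>u. x + r *\<^sub>R u) -` E"
    define e where "e = (1 / r) *\<^sub>R (z - x)"
    have "open E'" unfolding E'_def
      by (intro continuous_open_vimage E) (auto intro!: continuous_intros)
    have e: "norm e = 1" using r z by (simp add: e_def dist_norm)
    have "E' \<inter> ball e 1 = {}"
    proof -
      have "x + r *\<^sub>R u \<in> ball z r" if "u \<in> ball e 1" for u
      proof -
        have "z - (x + r *\<^sub>R u) = r *\<^sub>R (e - u)" using r by (simp add: e_def algebra_simps)
        then show ?thesis using that r by (simp add: dist_norm)
      qed
      then show ?thesis using ext by (auto simp: E'_def)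
    qed
    moreover have "measure lebesgue (E' \<inter> ball 0 1) \<le> \<delta>"
    proof -
      \<comment> \<open>The unit ball is mapped onto \<open>ball x r\<close>, which lies in
        \<open>ball z (2 * r)\<close> because z has distance r from x.\<close>
      have sub: "(\<lambda>u. r *\<^sub>R u + x) ` (E' \<inter> ball 0 1) \<subseteq> E \<inter> ball z (2 * r)"
      proof clarify
        fix u assume u: "u \<in> E'" "u \<in> ball 0 1"
        have "dist z (r *\<^sub>R u + x) \<le> dist z x + norm (r *\<^sub>R u)"
          by (metis add.commute dist_norm dist_triangle add_diff_cancel_right' norm_minus_commute)
        also have "\<dots> < 2 * r" using u z r by simp
        finally show "r *\<^sub>R u + x \<in> E \<inter> ball z (2 * r)"
          using u by (simp add: E'_def add.commute)
      qed
      have [measurable]: "E' \<inter> ball 0 1 \<in> sets lebesgue" using \<open>open E'\<close> by auto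
      have "r ^ DIM('a) * measure lebesgue (E' \<inter> ball 0 1)
        = measure lebesgue ((\<lambda>u. r *\<^sub>R u + x) ` (E' \<inter> ball 0 1))"
        using measure_lebesgue_affine[of r x "E' \<inter> ball 0 1"] r by simp
      also have "\<dots> \<le> measure lebesgue (E \<inter> ball z (2 * r))"
      proof (rule measure_mono_fmeasurable[OF sub])
        have "open ((\<lambda>u. r *\<^sub>R u + x) ` (E' \<inter> ball 0 1))"
          using open_affinity[of "E' \<inter> ball 0 1" r x] \<open>open E'\<close> r by (auto simp: add.commute)
        then show "(\<lambda>u. r *\<^sub>R u + x) ` (E' \<inter> ball 0 1) \<in> sets lebesgue" by simp
        show "E \<inter> ball z (2 * r) \<in> lmeasurable"
          using E by (auto intro: lmeasurable_open)
      qed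
      also have "\<dots> \<le> r ^ DIM('a) * \<delta>" using small by (simp add: mult.commute)
      finally show ?thesis using r by simp
    qed
    ultimately have ge: "trunc_s_curv s E' 0 \<epsilon> \<ge> 1" if "0 < \<epsilon>" "\<epsilon> < \<eta>" for \<epsilon>
      using curv[OF \<open>open E'\<close> e] that by blast
    \<comment> \<open>Scaling back turns the bound 1 into r^(-s), valid for all truncation radii
      below \<eta> r.\<close>
    have "\<forall>\<^sub>F \<epsilon> in at_right 0. r powr (- s) \<le> trunc_s_curv s E x \<epsilon>"
    proof (rule eventually_at_rightI)
      show "0 < \<eta> * r" using \<delta> r by simp
      fix \<epsilon> assume "\<epsilon> \<in> {0<..<\<eta> * r}"
      then have "1 \<le> trunc_s_curv s E' 0 (\<epsilon> / r)" using r by (intro ge) (auto simp: field_simps)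
      then show "r powr (- s) \<le> trunc_s_curv s E x \<epsilon>"
        unfolding trunc_s_curv_scale[OF E r] E'_def[symmetric] using r by simp
    qed
    with H have "r powr (- s) \<le> 0"
      unfolding s_mean_curvature_is_def by (intro tendsto_lowerbound) auto
    then show False using r by simp
  qed
  then show ?thesis using that \<delta> by blast
qed

section \<open>Covering the exterior points near the origin\<close>

theorem theorem1p1:
  fixes s :: real
  assumes "0 < s" "s < 1"
  shows "\<exists>C > 0. \<forall>\<alpha> (E :: ('a::euclidean_space) set).
           s < \<alpha> \<longrightarrow> \<alpha> < 1 \<longrightarrow> open E \<longrightarrow> C1_alpha_boundary \<alpha> E \<longrightarrow> 0 \<in> frontier E \<longrightarrow>
           (\<forall>x \<in> frontier E. s_mean_curvature_is s E x 0) \<longrightarrow>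
           (\<forall>R > 0. measure lebesgue (E \<inter> ball 0 R) \<ge> C * measure lebesgue (ball (0::'a) R))"
proof -
  obtain \<delta> :: real where \<delta>: "\<delta> > 0" and vol:
    "\<And>(E::'a set) x z r. \<lbrakk>open E; s_mean_curvature_is s E x 0; r > 0; dist z x = r;
       E \<inter> ball z r = {}\<rbrakk> \<Longrightarrow> \<delta> * r ^ DIM('a) \<le> measure lebesgue (E \<inter> ball z (2 * r))"
    using volume_near_tangent_exterior_ball[OF assms] by metis
  define \<omega> where "\<omega> = unit_ball_vol (real DIM('a))"
  have \<omega>: "\<omega> > 0" by (simp add: \<omega>_def)
  have ball_vol: "measure lebesgue (ball x r) = \<omega> * r ^ DIM('a)" if "r \<ge> 0" for x :: 'a and r
    using that by (simp add: content_ball \<omega>_def)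
  \<comment> \<open>Ratio of the volume of a ball of radius 10 \<rho>, a Vitali ball enlarged five
    times, to the guaranteed volume \<delta> \<rho>^d of \<open>E\<close>.\<close>
  define K where "K = \<omega> * 10 ^ DIM('a) / \<delta>"
  have K: "K > 0" using \<omega> \<delta> by (simp add: K_def)
  define C where "C = 1 / (10 ^ DIM('a) * (1 + K))"
  have "C * measure lebesgue (ball (0::'a) R) \<le> measure lebesgue (E \<inter> ball 0 R)"
    if E: "open E" and bd: "C1_alpha_boundary \<alpha> E" and 0: "0 \<in> frontier E"
      and H: "\<forall>x \<in> frontier E. s_mean_curvature_is s E x 0" and R: "R > 0" for E :: "'a set" and \<alpha> R
  proof -
    define M where "M = measure lebesgue (E \<inter> ball 0 R)"
    \<comment> \<open>The radius R/10 leaves room: an exterior point z here has distance at most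
      R/10 to the closure of \<open>E\<close>, which contains 0, so the ball around z of twice that
      distance stays in \<open>ball 0 R\<close>.\<close>
    define S where "S = ball 0 (R / 10) - closure E"
    have "\<exists>r. 0 < r \<and> r \<le> R / 10 \<and> \<delta> * r ^ DIM('a) \<le> measure lebesgue (E \<inter> ball z (2 * r))"
      if z: "z \<in> S" for z
    proof -
      have 0: "0 \<in> closure E" using 0 by (simp add: frontier_def)
      then have "closure E \<noteq> {}" by auto
      then have "\<exists>x\<in>closure E. \<forall>y\<in>closure E. dist z x \<le> dist z y"
        by (metis closed_closure distance_attains_inf)
      then obtain x where x: "x \<in> closure E" "\<And>y. y \<in> closure E \<Longrightarrow> dist z x \<le> dist z y"
        by auto
      have "dist z x > 0" using z x by (auto simp: S_def)
      have disj: "closure E \<inter> ball z (dist z x) = {}" using x(2) by force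
      have "x \<notin> E"
      proof -
        have "E \<inter> ball z (dist z x) = {}" using disj closure_subset[of E] by auto
        \<comment> \<open>An open set that misses a ball misses its closure, which contains the
          nearest point \<open>x\<close>. Hence \<open>x\<close> is a boundary point touched by an
          exterior ball.\<close>
        then have "E \<inter> closure (ball z (dist z x)) = {}"
          using open_Int_closure_eq_empty[OF E] by simp
        then show ?thesis using \<open>dist z x > 0\<close> by auto
      qed
      then have "x \<in> frontier E" using x E by (simp add: frontier_def interior_open)
      then have "\<delta> * dist z x ^ DIM('a) \<le> measure lebesgue (E \<inter> ball z (2 * dist z x))"
        using \<open>dist z x > 0\<close> disj closure_subset[of E] E H by (intro vol[of E x]) auto
      moreover have "dist z x \<le> R / 10" using x(2)[OF 0] z by (simp add: S_def)
      ultimately show ?thesis using \<open>dist z x > 0\<close> by blast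
    qed
    then obtain \<rho> where \<rho>: "\<And>z. z \<in> S \<Longrightarrow> 0 < \<rho> z \<and> \<rho> z \<le> R / 10 \<and>
        \<delta> * \<rho> z ^ DIM('a) \<le> measure lebesgue (E \<inter> ball z (2 * \<rho> z))"
      by metis
    have S_cover: "S \<subseteq> (\<Union>i\<in>S. ball i (2 * \<rho> i))" using \<rho> by force
    have radii: "0 < 2 * \<rho> i \<and> 2 * \<rho> i \<le> R / 5" if "i \<in> S" for i using \<rho>[OF that] by simp
    obtain J where J: "countable J" "J \<subseteq> S"
      "pairwise (\<lambda>i j. disjnt (ball i (2 * \<rho> i)) (ball j (2 * \<rho> j))) J"
      "S \<subseteq> (\<Union>i\<in>J. ball i (5 * (2 * \<rho> i)))"
      by (rule Vitali_covering_lemma_balls[where a = "\<lambda>i. i" and r = "\<lambda>i. 2 * \<rho> i", OF S_cover radii])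
        (assumption, rule that)
    have E_ball: "E \<inter> ball z r \<in> lmeasurable" for z r
      using E by (auto intro: lmeasurable_open)
    \<comment> \<open>Since the selected balls are disjoint, their pieces of \<open>E\<close> add up
      to at most M. The bound is uniform over finite subfamilies and therefore passes to the
      countable union.\<close>
    have fin_bound: "measure lebesgue (\<Union>i\<in>I. ball i (5 * (2 * \<rho> i))) \<le> K * M"
      if I: "I \<subseteq> J" "finite I" for I
    proof -
      have IS: "I \<subseteq> S" using I J by blast
      have "measure lebesgue (\<Union>i\<in>I. ball i (5 * (2 * \<rho> i))) \<le> (\<Sum>i\<in>I. measure lebesgue (ball i (5 * (2 * \<rho> i))))"
        by (intro measure_UNION_le I) auto
      also have "\<dots> \<le> (\<Sum>i\<in>I. K * measure lebesgue (E \<inter> ball i (2 * \<rho> i)))"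
      proof (rule sum_mono)
        fix i assume "i \<in> I"
        then have i: "0 < \<rho> i" "\<delta> * \<rho> i ^ DIM('a) \<le> measure lebesgue (E \<inter> ball i (2 * \<rho> i))"
          using \<rho> IS by auto
        have "measure lebesgue (ball i (5 * (2 * \<rho> i))) = K * (\<delta> * \<rho> i ^ DIM('a))"
          using i \<delta> by (subst ball_vol) (auto simp: K_def power_mult_distrib)
        also have "\<dots> \<le> K * measure lebesgue (E \<inter> ball i (2 * \<rho> i))"
          using i K by (intro mult_left_mono) auto
        finally show "measure lebesgue (ball i (5 * (2 * \<rho> i))) \<le> K * measure lebesgue (E \<inter> ball i (2 * \<rho> i))" .
      qed
      also have "\<dots> = K * measure lebesgue (\<Union>i\<in>I. E \<inter> ball i (2 * \<rho> i))"
      proof -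
        have "measure lebesgue (\<Union>i\<in>I. E \<inter> ball i (2 * \<rho> i)) = (\<Sum>i\<in>I. measure lebesgue (E \<inter> ball i (2 * \<rho> i)))"
        proof (rule measure_UNION_AE[OF I(2) E_ball, THEN trans])
          show "pairwise (\<lambda>i j. AE x in lebesgue. x \<notin> E \<inter> ball i (2 * \<rho> i) \<or> x \<notin> E \<inter> ball j (2 * \<rho> j)) I"
            using pairwise_subset[OF J(3) I(1)]
            by (rule pairwise_mono) (auto simp: disjnt_iff)
        qed simp
        then show ?thesis by (simp add: sum_distrib_left)
      qed
      also have "\<dots> \<le> K * M"
        unfolding M_def
      proof (intro mult_left_mono measure_mono_fmeasurable E_ball)
        show "(\<Union>i\<in>I. E \<inter> ball i (2 * \<rho> i)) \<subseteq> E \<inter> ball 0 R"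
        proof
          fix y assume "y \<in> (\<Union>i\<in>I. E \<inter> ball i (2 * \<rho> i))"
          then obtain i where i: "i \<in> I" and y: "y \<in> E" "y \<in> ball i (2 * \<rho> i)" by blast
          have "norm i < R / 10" "\<rho> i \<le> R / 10" using i IS \<rho> by (auto simp: S_def)
          moreover have "norm y \<le> norm i + dist i y"
            by (metis dist_0_norm dist_triangle)
          ultimately show "y \<in> E \<inter> ball 0 R" using y R by simp
        qed
        show "(\<Union>i\<in>I. E \<inter> ball i (2 * \<rho> i)) \<in> sets lebesgue"
          using I E by (intro sets.finite_UN) auto
      qed (use K in auto)
      finally show ?thesis .
    qed
    define U where "U = (\<Union>i\<in>J. ball i (5 * (2 * \<rho> i)))"
    have U: "U \<in> lmeasurable" "measure lebesgue U \<le> K * M"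
      unfolding U_def using fin_bound
      by (auto intro!: fmeasurable_UN_bound[OF J(1)] measure_UN_bound[OF J(1)])
    have neg: "negligible (frontier E)"
      using C1_alpha_boundary_imp_negligible_frontier[OF E bd] .
    then have fr: "frontier E \<in> lmeasurable" by (rule negligible_imp_measurable)
    \<comment> \<open>A point of the small ball lies in \<open>E\<close>, on the frontier, or in
      \<open>S\<close> and hence in \<open>U\<close>. Taking measures gives \<omega> (R/10)^d \<le>
      (1 + K) M, which explains the choice of \<open>C\<close>.\<close>
    have cover: "ball 0 (R / 10) \<subseteq> (E \<inter> ball 0 R) \<union> U \<union> frontier E"
    proof
      fix y :: 'a assume y: "y \<in> ball 0 (R / 10)"
      then have "y \<in> ball 0 R" using R by simp
      then show "y \<in> (E \<inter> ball 0 R) \<union> U \<union> frontier E"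
        using y J(4) E unfolding S_def U_def frontier_def by (auto simp: interior_open)
    qed
    have "\<omega> * (R / 10) ^ DIM('a) = measure lebesgue (ball (0::'a) (R / 10))"
      using R by (intro ball_vol[symmetric]) simp
    also have "\<dots> \<le> measure lebesgue ((E \<inter> ball 0 R) \<union> U \<union> frontier E)"
      by (intro measure_mono_fmeasurable[OF cover] fmeasurable.Un E_ball U fr) simp
    also have "\<dots> \<le> measure lebesgue (E \<inter> ball 0 R) + measure lebesgue U + measure lebesgue (frontier E)"
      by (intro order_trans[OF measure_Un_le] add_mono order_refl measure_Un_le sets.Un
          fmeasurableD E_ball U fr)
    also have "\<dots> \<le> M + K * M"
      using U negligible_imp_measure0[OF neg] unfolding M_def by linarith
    finally have "\<omega> * R ^ DIM('a) \<le> 10 ^ DIM('a) * ((1 + K) * M)"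
      by (simp add: power_divide field_simps)
    then have "C * (\<omega> * R ^ DIM('a)) \<le> C * (10 ^ DIM('a) * ((1 + K) * M))"
      using K by (intro mult_left_mono) (auto simp: C_def)
    also have "\<dots> = M" using K by (simp add: C_def)
    finally show ?thesis using R ball_vol[of R "0::'a"] by (simp add: M_def)
  qed
  moreover have "C > 0" using K by (simp add: C_def)
  ultimately show ?thesis by blast
qed

end
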